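(* Let $P>0$ be the total transmit power, $\tau\in[0,1)$ the timing mismatch, $Q=2\tau(1-\tau)$, and let $\tilde H_1,\tilde H_2$ be the quantized channel gains of two users (as described in the context), with $\tilde H_{\min}=\min\{\tilde H_1,\tilde H_2\}$. Let $\alpha_{\mathrm N}^*$ and $\alpha_{\mathrm A}^*$ be the max-min optimal power coefficients of NOMA and of ANOMA with timing mismatch $\tau$, respectively, both as defined in the context. For real $z$ put $$\alpha_{\mathrm A}^*(z)=\frac{2\tilde H_{\min}}{\sqrt{(\tilde H_1+\tilde H_2-zP\tilde H_{\min}^2Q)^2+4\tilde H_{\min}(P\tilde H_1\tilde H_2+zP\tilde H_{\min}^2Q)}+\tilde H_1+\tilde H_2-zP\tilde H_{\min}^2Q}.$$ Then $$\alpha_{\mathrm N}^*\le\alpha_{\mathrm A}^*(0.5)\le\alpha_{\mathrm A}^*\le\alpha_{\mathrm A}^*(1),$$ where the equal sign is achieved when $\tau=0$.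
   Context: Two-user downlink: a base station with total transmit power $P$ serves two users with superimposed signals offset in time by a fraction $\tau$ of the symbol interval (asynchronous non-orthogonal multiple access, ANOMA). NOMA is the special case $\tau=0$. Quantized gains: User $i$ has channel gain $H_i=|h_i|^2$, where $h_i$ is its channel coefficient, and feeds back $\tilde H_i=q(H_i)$, where $q$ is a scalar quantizer with levels $0=q_0<q_1<\cdots<q_{N-1}$ (the levels may differ between the users) that rounds down: $q(x)=q_k$ if $q_k\le x<q_{k+1}$ for $k=0,\dots,N-2$, and $q(x)=q_{N-1}$ if $x\ge q_{N-1}$. Let $\tilde H_{\max}=\max\{\tilde H_1,\tilde H_2\}$ and $\tilde H_{\min}=\min\{\tilde H_1,\tilde H_2\}$. The user with quantized gain $\tilde H_{\max}$ is treated as the strong user (if the quantized gains are equal, User 1 is taken as the strong one), and the other, with quantized gain $\tilde H_{\min}$, as the weak user. A power coefficient $\alpha\in(0,1)$ means that power $\alpha P$ is allocated to the strong user and $(1-\alpha)P$ to the weak user. With $Q=2\tau(1-\tau)$, the rates are $$R_{\mathrm{strong}}(\alpha)=\log_2\left(1+\alpha P\tilde H_{\max}\right),$$ $$R_{\mathrm{weak}}(\alpha)=\log_2\left(\frac{A(\alpha)+\sqrt{A(\alpha)^2-\alpha^2(1-\alpha)^2P^4\tilde H_{\min}^4Q^2}}{2(1+\alpha P\tilde H_{\min})}\right),$$ where $$A(\alpha)=1+P\tilde H_{\min}+\alpha(1-\alpha)P^2\tilde H_{\min}^2Q.$$ The max-min optimal power coefficient of ANOMA is $$\alpha_{\mathrm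 A}^*=\arg\max_{\alpha}\min\{R_{\mathrm{strong}}(\alpha),R_{\mathrm{weak}}(\alpha)\}.$$ In $\alpha$, $R_{\mathrm{strong}}$ is increasing and $R_{\mathrm{weak}}$ is decreasing, and $\alpha_{\mathrm A}^*$ is obtained by solving $R_{\mathrm{strong}}(\alpha)=R_{\mathrm{weak}}(\alpha)$. Here $\alpha_{\mathrm A}^*$ (no argument) denotes this optimal coefficient, while $\alpha_{\mathrm A}^*(z)$ (with an argument) denotes the explicit function given in the claim. The max-min optimal power coefficient $\alpha_{\mathrm N}^*$ of NOMA is the same quantity with $\tau=0$ (so $Q=0$). It is given by $$\alpha_{\mathrm N}^*=\frac{2\tilde H_{\min}}{\sqrt{(\tilde H_1+\tilde H_2)^2+4P\tilde H_1\tilde H_2\tilde H_{\min}}+\tilde H_1+\tilde H_2}.$$ *)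

theory Defs
  imports Complex_Main
begin

definition quantizer_levels :: "nat \<Rightarrow> (nat \<Rightarrow> real) \<Rightarrow> bool" where
  "quantizer_levels N q \<longleftrightarrow> 0 < N \<and> q 0 = 0 \<and> strict_mono_on {..<N} q"

(* Meaningful for quantizer_levels N q and x \<ge> 0; the index in the second branch is then unique. *)
definition quantize :: "nat \<Rightarrow> (nat \<Rightarrow> real) \<Rightarrow> real \<Rightarrow> real" where
  "quantize N q x =
     (if q (N - 1) \<le> x then q (N - 1)
      else q (THE k. Suc k < N \<and> q k \<le> x \<and> x < q (Suc k)))"

definition Qfactor :: "real \<Rightarrow> real" where
  "Qfactor \<tau> = 2 * \<tau> * (1 - \<tau>)"

(* From here on H1 and H2 are the quantized gains. The user with gain max H1 H2 is the strong one;
   the rates depend on the user labels only through max and min, so the tie-break is invisible. *)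

definition R_strong :: "real \<Rightarrow> real \<Rightarrow> real \<Rightarrow> real \<Rightarrow> real" where
  "R_strong P H1 H2 \<alpha> = log 2 (1 + \<alpha> * P * max H1 H2)"

definition A_term :: "real \<Rightarrow> real \<Rightarrow> real \<Rightarrow> real \<Rightarrow> real \<Rightarrow> real" where
  "A_term P \<tau> H1 H2 \<alpha> =
     1 + P * min H1 H2 + \<alpha> * (1 - \<alpha>) * P^2 * (min H1 H2)^2 * Qfactor \<tau>"

definition R_weak :: "real \<Rightarrow> real \<Rightarrow> real \<Rightarrow> real \<Rightarrow> real \<Rightarrow> real" where
  "R_weak P \<tau> H1 H2 \<alpha> =
     log 2 ((A_term P \<tau> H1 H2 \<alpha>
             + sqrt ((A_term P \<tau> H1 H2 \<alpha>)^2
                     - \<alpha>^2 * (1 - \<alpha>)^2 * P^4 * (min H1 H2)^4 * (Qfactor \<tau>)^2))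
            / (2 * (1 + \<alpha> * P * min H1 H2)))"

definition min_rate :: "real \<Rightarrow> real \<Rightarrow> real \<Rightarrow> real \<Rightarrow> real \<Rightarrow> real" where
  "min_rate P \<tau> H1 H2 \<alpha> = min (R_strong P H1 H2 \<alpha>) (R_weak P \<tau> H1 H2 \<alpha>)"

(* If the smaller gain is 0 (the lowest quantizer level), the weak rate vanishes identically and
   every coefficient is a maximizer, so the arg max does not determine a value. The value is then
   fixed as 0, the solution of R_strong = R_weak when the larger gain is positive; see
   R_weak_zero_gain and rates_equal_zero_gain_iff below. *)
definition alpha_opt :: "real \<Rightarrow> real \<Rightarrow> real \<Rightarrow> real \<Rightarrow> real" where
  "alpha_opt P \<tau> H1 H2 =
     (if min H1 H2 = 0 then 0
      else arg_max (min_rate P \<tau> H1 H2) (\<lambda>\<alpha>. 0 < \<alpha> \<and> \<alpha> < 1))"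

definition alpha_ANOMA :: "real \<Rightarrow> real \<Rightarrow> real \<Rightarrow> real \<Rightarrow> real" where
  "alpha_ANOMA P \<tau> H1 H2 = alpha_opt P \<tau> H1 H2"

definition alpha_NOMA :: "real \<Rightarrow> real \<Rightarrow> real \<Rightarrow> real" where
  "alpha_NOMA P H1 H2 = alpha_opt P 0 H1 H2"

(* If H1 = H2 = 0 the quotient is 0 / 0 = 0. *)
definition alpha_ANOMA_fun :: "real \<Rightarrow> real \<Rightarrow> real \<Rightarrow> real \<Rightarrow> real \<Rightarrow> real" where
  "alpha_ANOMA_fun P \<tau> H1 H2 z =
     2 * min H1 H2 /
     (sqrt ((H1 + H2 - z * P * (min H1 H2)^2 * Qfactor \<tau>)^2
            + 4 * min H1 H2 * (P * H1 * H2 + z * P * (min H1 H2)^2 * Qfactor \<tau>))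
      + H1 + H2 - z * P * (min H1 H2)^2 * Qfactor \<tau>)"

lemma R_weak_zero_gain:
  assumes "min H1 H2 = 0"
  shows "R_weak P \<tau> H1 H2 \<alpha> = 0"
  using assms by (simp add: R_weak_def A_term_def)

lemma rates_equal_zero_gain_iff:
  assumes "P > 0" "min H1 H2 = 0" "max H1 H2 > 0" "0 \<le> \<alpha>"
  shows "R_strong P H1 H2 \<alpha> = R_weak P \<tau> H1 H2 \<alpha> \<longleftrightarrow> \<alpha> = 0"
proof -
  have "0 \<le> \<alpha> * P * max H1 H2" using assms by simp
  then have "log 2 (1 + \<alpha> * P * max H1 H2) = 0 \<longleftrightarrow> \<alpha> * P * max H1 H2 = 0"
    by (simp add: log_def)
  with assms show ?thesis by (simp add: R_weak_zero_gain R_strong_def)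
qed

lemma quantize_top:
  "q (N - 1) \<le> x \<Longrightarrow> quantize N q x = q (N - 1)"
  by (simp add: quantize_def)

lemma quantize_cell:
  assumes q: "quantizer_levels N q" and k: "Suc k < N" "q k \<le> x" "x < q (Suc k)"
  shows "quantize N q x = q k"
proof -
  have mono: "q i \<le> q j" if "i \<le> j" "j < N" for i j
    using q that by (cases "i = j") (auto simp: quantizer_levels_def strict_mono_on_def less_imp_le)
  have "q (Suc k) \<le> q (N - 1)" using mono[of "Suc k" "N - 1"] k by simp
  then have "\<not> q (N - 1) \<le> x" using k by linarith
  moreover have "(THE j. Suc j < N \<and> q j \<le> x \<and> x < q (Suc j)) = k"
  proof (rule the_equality)
    fix j assume j: "Suc j < N \<and> q j \<le> x \<and> x < q (Suc j)"
    show "j = k"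
    proof (rule linorder_cases[of j k])
      assume "j < k" then show ?thesis using mono[of "Suc j" k] j k by simp
    next
      assume "k < j" then show ?thesis using mono[of "Suc k" j] j k by simp
    qed
  qed (use k in simp)
  ultimately show ?thesis by (simp add: quantize_def)
qed

end

theory Submission
  imports Defs
begin

text \<open>
  Write x = P H_min and B = \<alpha> (1 - \<alpha>) x^2 Q. The radicand in the weak rate factors as
  (1 + x) (1 + x + 2 B), which makes the numerator comparable with 1 + x + z B: half of it, f, lies
  between 1 + x + B/2 and 1 + x + B. The rates agree iff f = (1 + \<alpha> P H_max) (1 + \<alpha> x), while the
  explicit coefficient with parameter z is the positive root of the quadratic equation
  1 + x + z B = (1 + \<alpha> P H_max) (1 + \<alpha> x), so the bounds on f become bounds on the root.
\<close>

section \<open>Quantized gains and the mismatch factor\<close>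

text \<open>Leaves two cases for the theorem: the smaller gain is zero or positive.\<close>

lemma quantize_nonneg:
  assumes q: "quantizer_levels N q" and x: "0 \<le> x"
  shows "0 \<le> quantize N q x"
proof -
  have pos: "0 \<le> q k" if "k < N" for k
    using q that strict_mono_onD[of "{..<N}" q 0 k]
    by (cases "k = 0") (auto simp: quantizer_levels_def)
  have N: "0 < N" and q0: "q 0 = 0" using q by (auto simp: quantizer_levels_def)
  show ?thesis
  proof (cases "q (N - 1) \<le> x")
    case True
    then show ?thesis using pos[of "N - 1"] N by (simp add: quantize_top)
  next
    case False
    \<comment> \<open>The cell of \<open>x\<close> is found at the first index whose successor level
      exceeds \<open>x\<close>.\<close>
    have "\<exists>k<N - 1. (\<forall>i\<le>k. \<not> x < q i) \<and> x < q (Suc k)"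
      by (rule ex_least_nat_less) (use False q0 x in auto)
    then obtain k where k: "k < N - 1" "\<not> x < q k" "x < q (Suc k)" by auto
    then have "quantize N q x = q k" by (intro quantize_cell[OF q]) auto
    then show ?thesis using pos[of k] k by simp
  qed
qed

lemma Qfactor_nonneg: "0 \<le> \<tau> \<Longrightarrow> \<tau> < 1 \<Longrightarrow> 0 \<le> Qfactor \<tau>"
  by (simp add: Qfactor_def)

lemma Qfactor_le_half: "Qfactor \<tau> \<le> 1/2"
proof -
  have "0 \<le> (2 * \<tau> - 1)^2" by simp
  then show ?thesis by (simp add: Qfactor_def power2_eq_square algebra_simps)
qed

section \<open>Closed form and bounds for the weak rate\<close>

text \<open>This is the f of the overview, with the radicand already factored. Keeping
  \<open>2 * Q\<close> together makes the second factor the rational part with \<open>Q\<close>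
  doubled, so one monotonicity lemma serves both.\<close>

definition weak_num :: "real \<Rightarrow> real \<Rightarrow> real \<Rightarrow> real" where
  "weak_num x Q \<alpha> = ((1 + x + \<alpha> * (1 - \<alpha>) * x^2 * Q)
     + sqrt ((1 + x) * (1 + x + \<alpha> * (1 - \<alpha>) * x^2 * (2 * Q)))) / 2"

text \<open>Difference of squares: with A the rational part, A - B = 1 + x and A + B = 1 + x + 2
  B.\<close>

lemma R_weak_eq:
  "R_weak P \<tau> H1 H2 \<alpha> =
     log 2 (weak_num (P * min H1 H2) (Qfactor \<tau>) \<alpha> / (1 + \<alpha> * (P * min H1 H2)))"
proof -
  define m Q where "m = min H1 H2" and "Q = Qfactor \<tau>"
  have "(1 + P * m + \<alpha> * (1 - \<alpha>) * P^2 * m^2 * Q)^2 - \<alpha>^2 * (1 - \<alpha>)^2 * P^4 * m^4 * Q^2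
      = (1 + P * m) * (1 + P * m + \<alpha> * (1 - \<alpha>) * (P * m)^2 * (2 * Q))"
    by algebra
  then show ?thesis
    unfolding R_weak_def A_term_def weak_num_def m_def[symmetric] Q_def[symmetric]
    by (simp add: power_mult_distrib mult.assoc)
qed

text \<open>The root is the geometric mean of 1 + x and 1 + x + 2 B, so it lies between the smaller
  of them and their arithmetic mean 1 + x + B.\<close>

lemma weak_num_bounds:
  assumes "0 < x" "0 \<le> Q" "0 \<le> \<alpha>" "\<alpha> \<le> 1"
  shows "1 + x + \<alpha> * (1 - \<alpha>) * x^2 * Q / 2 \<le> weak_num x Q \<alpha>"
    and "weak_num x Q \<alpha> \<le> 1 + x + \<alpha> * (1 - \<alpha>) * x^2 * Q"
proof -
  define B where "B = \<alpha> * (1 - \<alpha>) * x^2 * Q"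
  have B: "0 \<le> B" using assms by (simp add: B_def)
  have eq: "weak_num x Q \<alpha> = (1 + x + B + sqrt ((1 + x) * (1 + x + 2 * B))) / 2"
    by (simp add: weak_num_def B_def algebra_simps)
  have "1 + x \<le> sqrt ((1 + x) * (1 + x + 2 * B))"
    by (rule real_le_rsqrt) (use assms B in \<open>simp add: power2_eq_square\<close>)
  moreover have "sqrt ((1 + x) * (1 + x + 2 * B)) \<le> 1 + x + B"
    by (rule real_le_lsqrt) (use assms B in \<open>auto simp: power2_eq_square algebra_simps\<close>)
  ultimately show "1 + x + \<alpha> * (1 - \<alpha>) * x^2 * Q / 2 \<le> weak_num x Q \<alpha>"
    and "weak_num x Q \<alpha> \<le> 1 + x + \<alpha> * (1 - \<alpha>) * x^2 * Q"
    unfolding eq B_def[symmetric] by auto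
qed

section \<open>Monotonicity of the weak rate\<close>

text \<open>Used with Q for the rational part of the weak rate and with 2 Q \<le> 1 for its square root.\<close>

lemma quadratic_ratio_decreasing:
  fixes x :: real
  assumes x: "0 < x" and Q: "0 \<le> Q" "Q \<le> 1" and ab: "0 \<le> a" "a < b" "b \<le> 1"
  shows "(1 + x + b * (1 - b) * x^2 * Q) * (1 + a * x)
       < (1 + x + a * (1 - a) * x^2 * Q) * (1 + b * x)"
proof -
  have "(1 - a - b) * (x * Q) \<le> 1 * (x * Q)"
    by (rule mult_right_mono) (use assms in auto)
  also have "\<dots> \<le> x" using x Q by (simp add: mult_left_le)
  finally have 1: "(1 - a - b) * (x * Q) < 1 + x" by simp
  have 2: "(1 - a - b) * (a * x^2 * Q) \<le> (1 - a) * (a * x^2 * Q)"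
    by (rule mult_right_mono) (use assms in auto)
  \<comment> \<open>The difference of the two sides has the factor \<open>(b - a) * x\<close>; the
    remaining bracket is positive by adding facts 1 and 2.\<close>
  have "0 < (b - a) * x * (1 + x + a * (1 - a) * x^2 * Q - (1 - a - b) * x * Q * (1 + a * x))"
    using 1 2 ab x
    by (intro mult_pos_pos) (auto simp: algebra_simps power2_eq_square)
  also have "\<dots> = (1 + x + a * (1 - a) * x^2 * Q) * (1 + b * x)
      - (1 + x + b * (1 - b) * x^2 * Q) * (1 + a * x)"
    by algebra
  finally show ?thesis by simp
qed

lemma weak_num_ratio_decreasing:
  assumes x: "0 < x" and Q: "0 \<le> Q" "Q \<le> 1/2" and ab: "0 \<le> a" "a < b" "b \<le> 1"
  shows "weak_num x Q b / (1 + b * x) < weak_num x Q a / (1 + a * x)"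
proof -
  define k where "k = (1 + a * x) / (1 + b * x)"
  define Ca Cb where "Ca = 1 + x + a * (1 - a) * x^2 * (2 * Q)"
    and "Cb = 1 + x + b * (1 - b) * x^2 * (2 * Q)"
  have pos: "0 < 1 + a * x" "0 < 1 + b * x"
    using x ab by (auto intro!: add_pos_nonneg)
  have k: "0 < k" "k \<le> 1" using pos x ab by (auto simp: k_def)
  have Cb: "0 \<le> Cb" using x Q ab by (simp add: Cb_def)
  have lin: "k * (1 + x + b * (1 - b) * x^2 * Q) < 1 + x + a * (1 - a) * x^2 * Q"
    using quadratic_ratio_decreasing[OF x, of Q a b] Q ab pos
    by (simp add: k_def pos_divide_less_eq mult_ac)
  have "k * Cb \<le> Ca"
    using quadratic_ratio_decreasing[OF x, of "2 * Q" a b] Q ab pos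
    by (simp add: k_def pos_divide_le_eq mult_ac Ca_def Cb_def)
  \<comment> \<open>Moving \<open>k\<close> under the root squares it; the extra factor is harmless
    because \<open>k \<le> 1\<close>.\<close>
  moreover have "k * (k * Cb) \<le> 1 * (k * Cb)"
    by (rule mult_right_mono) (use k Cb in auto)
  ultimately have "k * (k * Cb) \<le> Ca" by linarith
  then have "(1 + x) * (k * (k * Cb)) \<le> (1 + x) * Ca"
    by (rule mult_left_mono) (use x in simp)
  then have "sqrt (k^2 * ((1 + x) * Cb)) \<le> sqrt ((1 + x) * Ca)"
    by (simp add: power2_eq_square mult_ac)
  then have rt: "k * sqrt ((1 + x) * Cb) \<le> sqrt ((1 + x) * Ca)"
    using k by (simp add: real_sqrt_mult)
  have "k * weak_num x Q b < weak_num x Q a"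
    using lin rt unfolding weak_num_def Ca_def[symmetric] Cb_def[symmetric]
    by (simp add: distrib_left)
  then show ?thesis using pos by (simp add: k_def field_simps)
qed

section \<open>The max-min coefficient as a crossing point\<close>

text \<open>Strictly below the crossing point the increasing function, strictly above it the decreasing
  one, drops below the common value.\<close>

lemma arg_max_min_crossing:
  fixes f g :: "real \<Rightarrow> real"
  assumes f: "strict_mono_on {l<..<u} f"
    and g: "\<And>x y. l < x \<Longrightarrow> x < y \<Longrightarrow> y < u \<Longrightarrow> g y < g x"
    and c: "l < c" "c < u" "f c = g c"
  shows "is_arg_max (\<lambda>x. min (f x) (g x)) (\<lambda>x. l < x \<and> x < u) y \<longleftrightarrow> y = c"
proof -
  have less: "min (f x) (g x) < min (f c) (g c)" if x: "l < x" "x < u" "x \<noteq> c" for x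
  proof (cases "x < c")
    case True
    then have "f x < f c" using strict_mono_onD[OF f, of x c] x c by simp
    then show ?thesis using c by simp
  next
    case False
    then have "g x < g c" using g[of c x] x c by simp
    then show ?thesis using c by simp
  qed
  show ?thesis
  proof
    assume "is_arg_max (\<lambda>x. min (f x) (g x)) (\<lambda>x. l < x \<and> x < u) y"
    then show "y = c" using less[of y] c(1,2) unfolding is_arg_max_def by blast
  next
    assume "y = c"
    then show "is_arg_max (\<lambda>x. min (f x) (g x)) (\<lambda>x. l < x \<and> x < u) y"
      using less c(1,2) unfolding is_arg_max_def by (metis less_asym less_irrefl)
  qed
qed

text \<open>The intermediate value theorem yields a crossing of the two rates, and strict
  monotonicity makes it the unique maximizer. The final equation is equality of the rates without
  logarithm and denominator.\<close>

lemma min_rate_arg_max: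
  assumes P: "0 < P" and tau: "0 \<le> \<tau>" "\<tau> < 1" and m: "0 < min H1 H2"
  obtains c where "0 < c" "c < 1"
    "\<And>y. is_arg_max (min_rate P \<tau> H1 H2) (\<lambda>\<alpha>. 0 < \<alpha> \<and> \<alpha> < 1) y \<longleftrightarrow> y = c"
    "weak_num (P * min H1 H2) (Qfactor \<tau>) c =
       (1 + c * P * max H1 H2) * (1 + c * (P * min H1 H2))"
proof -
  define x M Q where "x = P * min H1 H2" and "M = P * max H1 H2" and "Q = Qfactor \<tau>"
  define s where "s = (\<lambda>\<alpha>. 1 + \<alpha> * M)"
  define w where "w = (\<lambda>\<alpha>. weak_num x Q \<alpha> / (1 + \<alpha> * x))"
  have x: "0 < x" using P m by (simp add: x_def)
  have M: "0 < M" using P m by (auto simp: M_def less_max_iff_disj)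
  have Q: "0 \<le> Q" "Q \<le> 1/2"
    using tau Qfactor_le_half[of \<tau>] by (auto simp: Q_def Qfactor_nonneg)
  have den: "0 < 1 + \<alpha> * x" if "0 \<le> \<alpha>" for \<alpha> using x that by (simp add: add_pos_nonneg)
  have num: "0 < weak_num x Q \<alpha>" if "0 \<le> \<alpha>" "\<alpha> \<le> 1" for \<alpha>
  proof -
    have "0 \<le> \<alpha> * (1 - \<alpha>) * x^2 * Q / 2" using that Q by simp
    then show ?thesis using weak_num_bounds(1)[OF x Q(1) that] x by linarith
  qed
  have wdec: "w b < w a" if "0 \<le> a" "a < b" "b \<le> 1" for a b
    using weak_num_ratio_decreasing[OF x Q that] by (simp add: w_def)
  have wpos: "0 < w \<alpha>" if "0 \<le> \<alpha>" "\<alpha> \<le> 1" for \<alpha>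
    using den num that by (simp add: w_def)
  have spos: "0 < s \<alpha>" if "0 \<le> \<alpha>" for \<alpha> using M that by (simp add: s_def add_pos_nonneg)
  have strong: "R_strong P H1 H2 \<alpha> = log 2 (s \<alpha>)" for \<alpha>
    by (simp add: R_strong_def s_def M_def mult.assoc)
  have weak: "R_weak P \<tau> H1 H2 \<alpha> = log 2 (w \<alpha>)" for \<alpha>
    by (simp add: R_weak_eq w_def x_def Q_def)
  \<comment> \<open>The product \<alpha> (1 - \<alpha>) vanishes at both ends, so \<open>w\<close>
    falls from 1 + x to 1 while \<open>s\<close> rises from 1 to 1 + M.\<close>
  have end0: "w 0 - s 0 > 0" using x by (simp add: w_def s_def weak_num_def)
  have end1: "w 1 - s 1 < 0" using x M by (simp add: w_def s_def weak_num_def)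
  have "continuous_on {0..1} (\<lambda>\<alpha>. w \<alpha> - s \<alpha>)"
    unfolding w_def s_def weak_num_def
    by (intro continuous_intros) (use den in \<open>auto simp: less_imp_neq\<close>, force)
  then have "\<exists>c\<ge>0. c \<le> 1 \<and> w c - s c = 0"
    using end0 end1 by (intro IVT2') auto
  then obtain c where c: "0 \<le> c" "c \<le> 1" "s c = w c" by auto
  with end0 end1 have "c \<noteq> 0" "c \<noteq> 1" by auto
  with c have c01: "0 < c" "c < 1" by auto
  have "is_arg_max (\<lambda>\<alpha>. min (log 2 (s \<alpha>)) (log 2 (w \<alpha>))) (\<lambda>\<alpha>. 0 < \<alpha> \<and> \<alpha> < 1) y \<longleftrightarrow> y = c" for y
  proof (rule arg_max_min_crossing)
    show "strict_mono_on {0<..<1} (\<lambda>\<alpha>. log 2 (s \<alpha>))"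
      using spos M by (auto simp: strict_mono_on_def) (simp add: s_def)
    show "log 2 (w b) < log 2 (w a)" if "0 < a" "a < b" "b < 1" for a b
      using wdec[of a b] wpos[of a] wpos[of b] that by simp
  qed (use c c01 in auto)
  then have "is_arg_max (min_rate P \<tau> H1 H2) (\<lambda>\<alpha>. 0 < \<alpha> \<and> \<alpha> < 1) y \<longleftrightarrow> y = c" for y
    by (simp add: min_rate_def[abs_def] strong weak)
  moreover have "weak_num x Q c = s c * (1 + c * x)"
    using c den[of c] by (simp add: w_def)
  ultimately show ?thesis
    using that c01 by (simp add: x_def Q_def s_def M_def mult.assoc)
qed

section \<open>Comparison with the explicit coefficient\<close>

text \<open>Here \<open>r\<close> is the positive root of a t^2 + b t - c in rationalized form.
  Splitting off t - r leaves a factor that is positive for positive t, so the sign of the quadratic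
  decides the comparison.\<close>

lemma le_positive_quadratic_root_iff:
  fixes a b c t :: real
  assumes a: "0 < a" and c: "0 < c" and t: "0 < t"
  defines "r \<equiv> 2 * c / (sqrt (b^2 + 4 * c * a) + b)"
  shows "t \<le> r \<longleftrightarrow> a * t^2 + b * t \<le> c"
    and "r \<le> t \<longleftrightarrow> c \<le> a * t^2 + b * t"
proof -
  define D where "D = sqrt (b^2 + 4 * c * a)"
  have ac: "0 < 4 * c * a" using a c by simp
  have D2: "D^2 = b^2 + 4 * c * a" using ac by (simp add: D_def)
  \<comment> \<open>This says |b| < D, so D + b is positive for either sign of
    \<open>b\<close>.\<close>
  have "sqrt (b^2) < D" unfolding D_def using ac by (simp only: real_sqrt_less_iff)
  then have S: "0 < D + b" by simp
  have r: "r * (D + b) = 2 * c" using S by (simp add: r_def D_def)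
  have "(2 * a * r) * (D + b) = (D - b) * (D + b)"
    using r D2 by algebra
  then have ar: "2 * a * r = D - b" using S by simp
  have fac: "a * t^2 + b * t - c = (t - r) * (a * t + (D + b) / 2)"
    using r ar by algebra
  have pos: "0 < a * t + (D + b) / 2" using a t S by (simp add: add_pos_pos)
  have "a * t^2 + b * t - c \<le> 0 \<longleftrightarrow> t \<le> r"
    unfolding fac using pos by (simp add: mult_le_0_iff)
  then show "t \<le> r \<longleftrightarrow> a * t^2 + b * t \<le> c" by auto
  have "0 \<le> a * t^2 + b * t - c \<longleftrightarrow> r \<le> t"
    unfolding fac using pos by (simp add: zero_le_mult_iff)
  then show "r \<le> t \<longleftrightarrow> c \<le> a * t^2 + b * t" by auto
qed

lemma alpha_ANOMA_fun_compare:
  assumes P: "0 < P" and tau: "0 \<le> \<tau>" "\<tau> < 1" and m: "0 < min H1 H2" and z: "0 \<le> z"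
    and t: "0 < t"
  defines "x \<equiv> P * min H1 H2"
  defines "L \<equiv> (1 + t * P * max H1 H2) * (1 + t * x)"
    and "U \<equiv> 1 + x + z * (t * (1 - t) * x^2 * Qfactor \<tau>)"
  shows "t \<le> alpha_ANOMA_fun P \<tau> H1 H2 z \<longleftrightarrow> L \<le> U"
    and "alpha_ANOMA_fun P \<tau> H1 H2 z \<le> t \<longleftrightarrow> U \<le> L"
proof -
  define n M Q where "n = min H1 H2" and "M = max H1 H2" and "Q = Qfactor \<tau>"
  have n: "0 < n" and M: "0 < M" using m by (auto simp: n_def M_def)
  have Q: "0 \<le> Q" using tau by (simp add: Q_def Qfactor_nonneg)
  \<comment> \<open>The explicit coefficient is symmetric in the gains, so they may be replaced by
    their minimum and maximum.\<close>
  have sum: "H1 + H2 = n + M" and prod: "P * H1 * H2 = P * n * M"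
    by (auto simp: n_def M_def min_def max_def)
  define a b where "a = P * n * M + z * P * n^2 * Q" and "b = n + M - z * P * n^2 * Q"
  have a: "0 < a" unfolding a_def using P n M Q z by (intro add_pos_nonneg) auto
  have fn: "alpha_ANOMA_fun P \<tau> H1 H2 z = 2 * n / (sqrt (b^2 + 4 * n * a) + b)"
  proof -
    have "alpha_ANOMA_fun P \<tau> H1 H2 z = 2 * n /
        (sqrt ((H1 + H2 - z * P * n^2 * Q)^2 + 4 * n * (P * H1 * H2 + z * P * n^2 * Q))
          + (H1 + H2 - z * P * n^2 * Q))"
      by (simp add: alpha_ANOMA_fun_def n_def Q_def add.assoc add_diff_eq)
    then show ?thesis by (simp only: sum prod a_def b_def)
  qed
  have diff: "L - U = P * (a * t^2 + b * t - n)"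
    unfolding L_def U_def x_def a_def b_def n_def[symmetric] M_def[symmetric] Q_def[symmetric]
    by algebra
  have "L \<le> U \<longleftrightarrow> P * (a * t^2 + b * t - n) \<le> 0" using diff by linarith
  also have "\<dots> \<longleftrightarrow> a * t^2 + b * t \<le> n" using P by (simp add: mult_le_0_iff)
  finally show "t \<le> alpha_ANOMA_fun P \<tau> H1 H2 z \<longleftrightarrow> L \<le> U"
    unfolding fn by (simp add: le_positive_quadratic_root_iff(1)[OF a n t])
  have "U \<le> L \<longleftrightarrow> 0 \<le> P * (a * t^2 + b * t - n)" using diff by linarith
  also have "\<dots> \<longleftrightarrow> n \<le> a * t^2 + b * t" using P by (simp add: zero_le_mult_iff)
  finally show "alpha_ANOMA_fun P \<tau> H1 H2 z \<le> t \<longleftrightarrow> U \<le> L"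
    unfolding fn by (simp add: le_positive_quadratic_root_iff(2)[OF a n t])
qed

text \<open>\<open>arg_max\<close> is a choice operator; uniqueness of the maximizer determines its
  value.\<close>

lemma alpha_opt_eqI:
  assumes "min H1 H2 \<noteq> 0"
    and "\<And>y. is_arg_max (min_rate P \<tau> H1 H2) (\<lambda>\<alpha>. 0 < \<alpha> \<and> \<alpha> < 1) y \<longleftrightarrow> y = c"
  shows "alpha_opt P \<tau> H1 H2 = c"
  using assms by (simp add: alpha_opt_def arg_max_def)

theorem theorem1:
  fixes P \<tau> H1 H2 :: real
    and h1 h2 :: complex
    and N1 N2 :: nat
    and q1 q2 :: "nat \<Rightarrow> real"
  assumes "P > 0"
    and "0 \<le> \<tau>" and "\<tau> < 1"
    and "quantizer_levels N1 q1" and "quantizer_levels N2 q2"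
    and "H1 = quantize N1 q1 ((cmod h1)^2)"
    and "H2 = quantize N2 q2 ((cmod h2)^2)"
  shows "(min H1 H2 > 0 \<longrightarrow>
           (\<exists>!\<alpha>. is_arg_max (min_rate P 0 H1 H2) (\<lambda>\<alpha>. 0 < \<alpha> \<and> \<alpha> < 1) \<alpha>) \<and>
           (\<exists>!\<alpha>. is_arg_max (min_rate P \<tau> H1 H2) (\<lambda>\<alpha>. 0 < \<alpha> \<and> \<alpha> < 1) \<alpha>))
       \<and> alpha_NOMA P H1 H2 \<le> alpha_ANOMA_fun P \<tau> H1 H2 (1/2)
       \<and> alpha_ANOMA_fun P \<tau> H1 H2 (1/2) \<le> alpha_ANOMA P \<tau> H1 H2
       \<and> alpha_ANOMA P \<tau> H1 H2 \<le> alpha_ANOMA_fun P \<tau> H1 H2 1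
       \<and> (\<tau> = 0 \<longrightarrow>
            alpha_NOMA P H1 H2 = alpha_ANOMA_fun P \<tau> H1 H2 (1/2) \<and>
            alpha_ANOMA_fun P \<tau> H1 H2 (1/2) = alpha_ANOMA P \<tau> H1 H2 \<and>
            alpha_ANOMA P \<tau> H1 H2 = alpha_ANOMA_fun P \<tau> H1 H2 1)"
proof -
  let ?I = "\<lambda>\<alpha>::real. 0 < \<alpha> \<and> \<alpha> < 1"
  let ?f = "alpha_ANOMA_fun P \<tau> H1 H2"
  have const: "?f z = ?f z'" if "\<tau> = 0" for z z'
    using that by (simp add: alpha_ANOMA_fun_def Qfactor_def)
  have "0 \<le> H1" "0 \<le> H2" using assms by (simp_all add: quantize_nonneg)
  then consider "min H1 H2 = 0" | "0 < min H1 H2" by fastforce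
  then show ?thesis
  proof cases
    case 1
    \<comment> \<open>All coefficients are 0 here: the optimal ones by convention, the explicit ones
      by their numerator.\<close>
    then show ?thesis
      by (simp add: alpha_NOMA_def alpha_ANOMA_def alpha_opt_def alpha_ANOMA_fun_def)
  next
    case m: 2
    let ?x = "P * min H1 H2"
    have P: "0 < P" and tau: "0 \<le> \<tau>" "\<tau> < 1" using assms by auto
    have x: "0 < ?x" using P m by simp
    have Q: "0 \<le> Qfactor \<tau>" using tau by (rule Qfactor_nonneg)
    obtain c where c: "0 < c" "c < 1"
      and c_max: "\<And>y. is_arg_max (min_rate P \<tau> H1 H2) ?I y \<longleftrightarrow> y = c"
      and c_eq: "weak_num ?x (Qfactor \<tau>) c = (1 + c * P * max H1 H2) * (1 + c * ?x)"
      using min_rate_arg_max[OF P tau m] by blast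
    obtain d where d: "0 < d" "d < 1"
      and d_max: "\<And>y. is_arg_max (min_rate P 0 H1 H2) ?I y \<longleftrightarrow> y = d"
      and d_eq: "weak_num ?x (Qfactor 0) d = (1 + d * P * max H1 H2) * (1 + d * ?x)"
      using min_rate_arg_max[of P 0 H1 H2] P m by auto
    have A: "alpha_ANOMA P \<tau> H1 H2 = c" and N: "alpha_NOMA P H1 H2 = d"
      using m c_max d_max by (auto simp: alpha_ANOMA_def alpha_NOMA_def intro!: alpha_opt_eqI)
    have "weak_num ?x 0 d = 1 + ?x" using x by (simp add: weak_num_def)
    then have d_root: "(1 + d * P * max H1 H2) * (1 + d * ?x) = 1 + ?x"
      using d_eq by (simp add: Qfactor_def)
    \<comment> \<open>At t = d the product side equals 1 + x, and the z-term on the other side can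
      only add to it.\<close>
    have "0 \<le> d * (1 - d) * ?x^2 * Qfactor \<tau>" using d Q by simp
    then have le1: "d \<le> ?f (1/2)"
      using d d_root by (subst alpha_ANOMA_fun_compare(1)[OF P tau m]) auto
    \<comment> \<open>The lower bound on \<open>weak_num\<close> is exactly the comparison
      expression at z = 1/2, the upper bound the one at z = 1.\<close>
    have le2: "?f (1/2) \<le> c"
      using c weak_num_bounds(1)[OF x Q, of c] c_eq
      by (subst alpha_ANOMA_fun_compare(2)[OF P tau m]) auto
    have le3: "c \<le> ?f 1"
      using c weak_num_bounds(2)[OF x Q, of c] c_eq
      by (subst alpha_ANOMA_fun_compare(1)[OF P tau m]) auto
    have "d = c" if "\<tau> = 0" using that A N by (simp add: alpha_ANOMA_def alpha_NOMA_def)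
    \<comment> \<open>With Q = 0 the explicit coefficient does not depend on z, so its values at 1/2
      and 1 squeeze \<open>c\<close>.\<close>
    then have "\<tau> = 0 \<longrightarrow> d = ?f (1/2) \<and> ?f (1/2) = c \<and> c = ?f 1"
      using le2 le3 const[of "1/2" 1] by auto
    then show ?thesis
      using le1 le2 le3 c_max d_max unfolding A N by auto
  qed
qed

end
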